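(* Let $A,B>0$ be bounded linear operators on a Hilbert space $\mathcal{H}$ such that $sA\le B\le tA$ for some scalars $0<s\le t$, and let $v\in\mathbb{R}$ with $v\notin[0,1]$. Then $$\min\{g_v(s),g_v(t)\}\,A\le A\nabla_vB-A\sharp_vB,$$ where $g_v(x)=(1-v)+vx-x^v$ for $s\le x\le t$.
   Context: Operators are bounded linear operators on a Hilbert space $\mathcal{H}$. $A\ge 0$ (positive) means $\langle Ax,x\rangle\ge 0$ for all $x\in\mathcal{H}$; $A>0$ (strictly positive) means $A$ is positive and invertible; for self-adjoint $A,B$, $A\le B$ means $B-A\ge 0$. For $A,B>0$ and real $v$ (here outside $[0,1]$), the same formulas as for the weighted means are used: $A\nabla_v B=(1-v)A+vB$ and $A\sharp_v B=A^{1/2}\left(A^{-1/2}BA^{-1/2}\right)^v A^{1/2}$, with powers defined by the continuous functional calculus. *)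

theory Defs
  imports "HOL-Analysis.Analysis" "HOL-Library.Nonpos_Ints" "HOL-Computational_Algebra.Polynomial"
begin

text \<open>Complex Hilbert spaces of arbitrary dimension. The inner product is linear in its first
  argument. Completeness is part of \<^class>\<open>banach\<close>; positive definiteness of the inner product
  is contained in the last axiom.\<close>

class complex_hilbert = banach +
  fixes scaleC :: "complex \<Rightarrow> 'a \<Rightarrow> 'a"  (infixr \<open>*\<^sub>C\<close> 75)
    and cinner :: "'a \<Rightarrow> 'a \<Rightarrow> complex"
  assumes scaleC_add_right: "c *\<^sub>C (x + y) = c *\<^sub>C x + c *\<^sub>C y"
    and scaleC_add_left: "(c + d) *\<^sub>C x = c *\<^sub>C x + d *\<^sub>C x"
    and scaleC_scaleC: "c *\<^sub>C d *\<^sub>C x = (c * d) *\<^sub>C x"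
    and scaleC_of_real: "complex_of_real r *\<^sub>C x = r *\<^sub>R x"
    and cinner_add_left: "cinner (x + y) z = cinner x z + cinner y z"
    and cinner_scaleC_left: "cinner (c *\<^sub>C x) y = c * cinner x y"
    and cinner_commute: "cinner x y = cnj (cinner y x)"
    and cinner_self: "cinner x x = complex_of_real ((norm x)\<^sup>2)"

instantiation complex :: complex_hilbert
begin

definition scaleC_complex :: "complex \<Rightarrow> complex \<Rightarrow> complex"
  where "scaleC_complex c x = c * x"

definition cinner_complex :: "complex \<Rightarrow> complex \<Rightarrow> complex"
  where "cinner_complex x y = x * cnj y"

instance
  by standard
    (auto simp: scaleC_complex_def cinner_complex_def algebra_simps scaleR_conv_of_real
      simp flip: complex_norm_square)

end

lemma norm_scaleC: "norm (c *\<^sub>C x) = norm c * norm (x :: 'a :: complex_hilbert)"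
proof -
  have "cinner (c *\<^sub>C x) (c *\<^sub>C x) = c * cnj c * cinner x x"
    by (metis (no_types, lifting) cinner_commute cinner_scaleC_left complex_cnj_mult mult.assoc
        mult.left_commute)
  then have "complex_of_real ((norm (c *\<^sub>C x))\<^sup>2) = complex_of_real ((norm c * norm x)\<^sup>2)"
    by (simp add: cinner_self power_mult_distrib flip: complex_norm_square)
  then have "(norm (c *\<^sub>C x))\<^sup>2 = (norm c * norm x)\<^sup>2"
    by (simp only: of_real_eq_iff)
  then show ?thesis
    by (simp add: power2_eq_iff_nonneg)
qed

lemma bounded_linear_scaleC: "bounded_linear (scaleC c :: 'a \<Rightarrow> 'a :: complex_hilbert)"
proof (rule bounded_linear_intro)
  show "c *\<^sub>C (r *\<^sub>R x) = r *\<^sub>R (c *\<^sub>C x)" for r and x :: 'a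
    by (simp add: scaleC_scaleC mult.commute flip: scaleC_of_real)
  show "norm (c *\<^sub>C x) \<le> norm x * norm c" for x :: 'a
    by (simp add: norm_scaleC mult.commute)
qed (rule scaleC_add_right)

text \<open>The type \<open>'a \<Rightarrow>\<^sub>L 'a\<close> only provides real-linear bounded maps. The operators on the Hilbert
  space are those that are also complex-linear.\<close>

definition clinear_op :: "('a::complex_hilbert \<Rightarrow>\<^sub>L 'a) \<Rightarrow> bool"
  where "clinear_op T \<longleftrightarrow> (\<forall>c x. blinfun_apply T (c *\<^sub>C x) = c *\<^sub>C blinfun_apply T x)"

lift_definition scalar_op :: "complex \<Rightarrow> 'a::complex_hilbert \<Rightarrow>\<^sub>L 'a" is scaleC
  by (rule bounded_linear_scaleC)

definition invertible_op :: "('a::complex_hilbert \<Rightarrow>\<^sub>L 'a) \<Rightarrow> bool"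
  where "invertible_op T \<longleftrightarrow>
    (\<exists>S. clinear_op S \<and> S o\<^sub>L T = id_blinfun \<and> T o\<^sub>L S = id_blinfun)"

definition positive_op :: "('a::complex_hilbert \<Rightarrow>\<^sub>L 'a) \<Rightarrow> bool"
  where "positive_op T \<longleftrightarrow> clinear_op T \<and> (\<forall>x. cinner (blinfun_apply T x) x \<in> \<real>\<^sub>\<ge>\<^sub>0)"

definition strictly_positive_op :: "('a::complex_hilbert \<Rightarrow>\<^sub>L 'a) \<Rightarrow> bool"
  where "strictly_positive_op T \<longleftrightarrow> positive_op T \<and> invertible_op T"

definition le_op :: "('a::complex_hilbert \<Rightarrow>\<^sub>L 'a) \<Rightarrow> ('a \<Rightarrow>\<^sub>L 'a) \<Rightarrow> bool"  (infix \<open>\<preceq>\<close> 50)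
  where "S \<preceq> T \<longleftrightarrow> positive_op (T - S)"

definition op_spectrum :: "('a::complex_hilbert \<Rightarrow>\<^sub>L 'a) \<Rightarrow> complex set"
  where "op_spectrum T = {z. \<not> invertible_op (T - scalar_op z)}"

definition op_power :: "('a::complex_hilbert \<Rightarrow>\<^sub>L 'a) \<Rightarrow> nat \<Rightarrow> ('a \<Rightarrow>\<^sub>L 'a)"
  where "op_power T n = (((o\<^sub>L) T) ^^ n) id_blinfun"

definition op_poly :: "real poly \<Rightarrow> ('a::complex_hilbert \<Rightarrow>\<^sub>L 'a) \<Rightarrow> ('a \<Rightarrow>\<^sub>L 'a)"
  where "op_poly p T = (\<Sum>i\<le>degree p. coeff p i *\<^sub>R op_power T i)"

text \<open>The continuous functional calculus of a self-adjoint operator \<open>T\<close> (whose spectrum is real)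
  at a real function \<open>f\<close> that is continuous on the spectrum: \<open>f(T)\<close> is the limit in operator norm
  of \<open>p\<^sub>n(T)\<close> for any polynomials \<open>p\<^sub>n\<close> that converge to \<open>f\<close> uniformly on the spectrum. For other
  \<open>T\<close> or \<open>f\<close> the value is unspecified.\<close>

definition cfc :: "(real \<Rightarrow> real) \<Rightarrow> ('a::complex_hilbert \<Rightarrow>\<^sub>L 'a) \<Rightarrow> ('a \<Rightarrow>\<^sub>L 'a)"
  where "cfc f T = (THE S. \<forall>p :: nat \<Rightarrow> real poly.
    uniform_limit {x. complex_of_real x \<in> op_spectrum T} (\<lambda>n. poly (p n)) f sequentially \<longrightarrow>
    (\<lambda>n. op_poly (p n) T) \<longlonglongrightarrow> S)"

definition op_powr :: "('a::complex_hilbert \<Rightarrow>\<^sub>L 'a) \<Rightarrow> real \<Rightarrow> ('a \<Rightarrow>\<^sub>L 'a)"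
  where "op_powr T v = cfc (\<lambda>x. x powr v) T"

definition arith_mean_op ::
    "real \<Rightarrow> ('a::complex_hilbert \<Rightarrow>\<^sub>L 'a) \<Rightarrow> ('a \<Rightarrow>\<^sub>L 'a) \<Rightarrow> ('a \<Rightarrow>\<^sub>L 'a)"
  where "arith_mean_op v A B = (1 - v) *\<^sub>R A + v *\<^sub>R B"

definition geom_mean_op ::
    "real \<Rightarrow> ('a::complex_hilbert \<Rightarrow>\<^sub>L 'a) \<Rightarrow> ('a \<Rightarrow>\<^sub>L 'a) \<Rightarrow> ('a \<Rightarrow>\<^sub>L 'a)"
  where "geom_mean_op v A B =
    op_powr A (1/2) o\<^sub>L
      op_powr (op_powr A (-1/2) o\<^sub>L B o\<^sub>L op_powr A (-1/2)) v o\<^sub>L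
    op_powr A (1/2)"

definition mean_gap :: "real \<Rightarrow> real \<Rightarrow> real"
  where "mean_gap v x = (1 - v) + v * x - x powr v"

end

theory Submission
  imports Defs "HOL-Computational_Algebra.Fundamental_Theorem_Algebra"
begin

text \<open>
  Put \<open>C = A\<^sup>-\<^sup>1\<^sup>/\<^sup>2 B A\<^sup>-\<^sup>1\<^sup>/\<^sup>2\<close>. Sandwiching with \<open>A\<^sup>1\<^sup>/\<^sup>2\<close> turns the asserted inequality into
  \<open>m \<le> (1 - v) + v C - C\<^sup>v\<close>, where \<open>m\<close> is the smaller of the two end values of the scalar gap, and
  turns the hypothesis into \<open>s \<le> C \<le> t\<close>, so that the spectrum of \<open>C\<close> lies in \<open>[s, t]\<close>. For \<open>v\<close>
  outside \<open>[0, 1]\<close> the power \<open>x\<^sup>v\<close> is convex, hence the gap is concave and at least \<open>m\<close> on \<open>[s, t]\<close>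
  (\<open>mean_gap_ge_min\<close>). A function that is nonnegative on an interval containing the spectrum is
  sent to a positive operator by the functional calculus (\<open>positive_op_cfc\<close>), which gives the claim.

  Most of the work is to show that the functional calculus, given as the limit over all polynomial
  approximations on the spectrum, exists and is multiplicative. The decisive fact is that a real
  polynomial that is nonnegative on the spectrum of a symmetric \<open>T\<close> has a nonnegative form at \<open>T\<close>
  (\<open>op_poly_form_nonneg\<close>). It comes from the factorization of real polynomials: a polynomial
  without zeros in the spectrum is bounded below at \<open>T\<close> (\<open>bounded_below_op_poly\<close>), and for an
  operator with nonnegative form this forces the form to be strictly positive. The bound
  \<open>\<parallel>p(T)\<parallel> \<le> sup \<bar>p\<bar>\<close> over the spectrum follows (\<open>norm_op_poly_le\<close>), and with it the convergence of
  \<open>p\<^sub>n(T)\<close> (\<open>cfc_tendsto\<close>). In the other direction, coercive operators are invertible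
  (\<open>coercive_imp_invertible\<close>), so bounds on the form of an operator locate its spectrum.
\<close>

section \<open>The real inner product and symmetric operators\<close>

definition rinner :: "'a::complex_hilbert \<Rightarrow> 'a \<Rightarrow> real"
  where "rinner x y = Re (cinner x y)"

definition symmetric_op :: "('a::complex_hilbert \<Rightarrow>\<^sub>L 'a) \<Rightarrow> bool"
  where "symmetric_op T \<longleftrightarrow> (\<forall>x y. rinner (T x) y = rinner x (T y))"

lemma rinner_commute: "rinner x y = rinner y x"
  unfolding rinner_def by (subst cinner_commute) simp

lemma rinner_add_left: "rinner (x + y) z = rinner x z + rinner y z"
  by (simp add: rinner_def cinner_add_left)

lemma rinner_scaleR_left: "rinner (r *\<^sub>R x) y = r * rinner x y"
  by (simp add: rinner_def cinner_scaleC_left flip: scaleC_of_real)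

lemma rinner_add_right: "rinner x (y + z) = rinner x y + rinner x z"
  by (metis rinner_add_left rinner_commute)

lemma rinner_scaleR_right: "rinner x (r *\<^sub>R y) = r * rinner x y"
  by (metis rinner_scaleR_left rinner_commute)

lemma rinner_minus_left: "rinner (- x) y = - rinner x y"
  using rinner_scaleR_left[of "-1" x y] by simp

lemma rinner_minus_right: "rinner x (- y) = - rinner x y"
  by (metis rinner_minus_left rinner_commute)

lemma rinner_diff_left: "rinner (x - y) z = rinner x z - rinner y z"
  using rinner_add_left[of x "- y" z] by (simp add: rinner_minus_left)

lemma rinner_diff_right: "rinner x (y - z) = rinner x y - rinner x z"
  by (metis rinner_diff_left rinner_commute)

lemmas rinner_simps = rinner_add_left rinner_add_right rinner_scaleR_left rinner_scaleR_right
  rinner_minus_left rinner_minus_right rinner_diff_left rinner_diff_right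

lemma rinner_self: "rinner x x = (norm x)\<^sup>2"
  by (simp add: rinner_def cinner_self)

lemma symmetric_opD: "symmetric_op T \<Longrightarrow> rinner (T x) y = rinner x (T y)"
  by (simp add: symmetric_op_def)

lemma symmetric_op_id: "symmetric_op id_blinfun"
  by (simp add: symmetric_op_def)

lemma symmetric_op_scaleR: "symmetric_op T \<Longrightarrow> symmetric_op (r *\<^sub>R T)"
  by (simp add: symmetric_op_def rinner_simps blinfun.scaleR_left)

lemma symmetric_op_sandwich:
  "symmetric_op S \<Longrightarrow> symmetric_op T \<Longrightarrow> symmetric_op (S o\<^sub>L T o\<^sub>L S)"
  by (simp add: symmetric_op_def)

lemma scaleC_scaleR: "c *\<^sub>C (r *\<^sub>R x) = r *\<^sub>R (c *\<^sub>C (x :: 'a::complex_hilbert))"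
  by (simp add: scaleC_scaleC mult.commute flip: scaleC_of_real)

lemma scaleC_minus: "c *\<^sub>C (- x) = - (c *\<^sub>C (x :: 'a::complex_hilbert))"
  using scaleC_scaleR[of c "-1" x] by simp

lemma scaleC_diff: "c *\<^sub>C (x - y) = c *\<^sub>C x - c *\<^sub>C (y :: 'a::complex_hilbert)"
  using scaleC_add_right[of c x "- y"] by (simp add: scaleC_minus)

lemma clinear_opD: "clinear_op T \<Longrightarrow> T (c *\<^sub>C x) = c *\<^sub>C T x"
  by (simp add: clinear_op_def)

lemma clinear_op_id: "clinear_op id_blinfun"
  by (simp add: clinear_op_def)

lemma clinear_op_add: "clinear_op S \<Longrightarrow> clinear_op T \<Longrightarrow> clinear_op (S + T)"
  by (simp add: clinear_op_def blinfun.add_left scaleC_add_right)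

lemma clinear_op_diff: "clinear_op S \<Longrightarrow> clinear_op T \<Longrightarrow> clinear_op (S - T)"
  by (simp add: clinear_op_def blinfun.diff_left scaleC_diff)

lemma clinear_op_scaleR: "clinear_op T \<Longrightarrow> clinear_op (r *\<^sub>R T)"
  by (simp add: clinear_op_def blinfun.scaleR_left scaleC_scaleR)

lemma clinear_op_compose: "clinear_op S \<Longrightarrow> clinear_op T \<Longrightarrow> clinear_op (S o\<^sub>L T)"
  by (simp add: clinear_op_def)

lemma cinner_scaleC_right: "cinner x (c *\<^sub>C y) = cnj c * cinner x y"
  by (metis cinner_commute cinner_scaleC_left complex_cnj_mult)

lemma cinner_add_right: "cinner x (y + z) = cinner x y + cinner x z"
  by (metis cinner_add_left cinner_commute complex_cnj_add)

lemma rinner_scaleC_ii: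
  "rinner (\<i> *\<^sub>C x) y = - Im (cinner x y)" "rinner x (\<i> *\<^sub>C y) = Im (cinner x y)"
  by (simp_all add: rinner_def cinner_scaleC_left cinner_scaleC_right)

text \<open>Over the complex numbers, a real quadratic form already forces symmetry, by polarization
  at \<open>x + \<i> y\<close>. This is what lets all later arguments use the real inner product only.\<close>

lemma positive_op_iff:
  "positive_op T \<longleftrightarrow> clinear_op T \<and> symmetric_op T \<and> (\<forall>x. 0 \<le> rinner (T x) x)"
proof (intro iffI conjI allI)
  assume pos: "positive_op T"
  then show lin: "clinear_op T"
    by (simp add: positive_op_def)
  have real: "Im (cinner (T x) x) = 0" and nonneg: "0 \<le> Re (cinner (T x) x)" for x
    using pos by (simp_all add: positive_op_def complex_nonneg_Reals_iff)
  show "0 \<le> rinner (T x) x" for x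
    using nonneg by (simp add: rinner_def)
  show "symmetric_op T"
    unfolding symmetric_op_def
  proof (intro allI)
    fix x y
    have "Im (cinner (T (x + \<i> *\<^sub>C y)) (x + \<i> *\<^sub>C y)) = 0"
      by (rule real)
    then have "Re (cinner (T x) y) = Re (cinner (T y) x)"
      using real[of x] real[of y]
      by (simp add: blinfun.add_right clinear_opD[OF lin] cinner_add_left cinner_add_right
          cinner_scaleC_left cinner_scaleC_right)
    then show "rinner (T x) y = rinner x (T y)"
      by (metis rinner_commute rinner_def)
  qed
next
  assume T: "clinear_op T \<and> symmetric_op T \<and> (\<forall>x. 0 \<le> rinner (T x) x)"
  have "cinner (T x) x \<in> \<real>\<^sub>\<ge>\<^sub>0" for x
  proof -
    have "rinner (T x) (\<i> *\<^sub>C x) = rinner x (T (\<i> *\<^sub>C x))"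
      using T by (simp add: symmetric_op_def)
    also have "\<dots> = rinner (\<i> *\<^sub>C T x) x"
      using T by (simp add: clinear_op_def rinner_commute)
    finally have "Im (cinner (T x) x) = 0"
      by (simp add: rinner_scaleC_ii)
    then show ?thesis
      using T by (simp add: complex_nonneg_Reals_iff rinner_def)
  qed
  then show "positive_op T"
    using T by (simp add: positive_op_def)
qed

text \<open>The form of \<open>T\<close> may be degenerate. If \<open>\<langle>T y, y\<rangle> = 0\<close>, the form at \<open>x + r y\<close> is affine in \<open>r\<close>,
  and nonnegativity forces its slope to vanish; otherwise it is minimized over \<open>r\<close>.\<close>

lemma form_Cauchy_Schwarz:
  assumes sym: "symmetric_op T" and nonneg: "\<And>x. 0 \<le> rinner (T x) x"
  shows "(rinner (T x) y)\<^sup>2 \<le> rinner (T x) x * rinner (T y) y"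
proof -
  have swap: "rinner (T y) x = rinner (T x) y"
    using sym by (metis rinner_commute symmetric_op_def)
  have quad: "0 \<le> rinner (T x) x + 2 * r * rinner (T x) y + r\<^sup>2 * rinner (T y) y" for r
    using nonneg[of "x + r *\<^sub>R y"] swap
    by (simp add: blinfun.add_right blinfun.scaleR_right rinner_simps algebra_simps power2_eq_square)
  show ?thesis
  proof (cases "rinner (T y) y = 0")
    case True
    have "rinner (T x) y = 0"
    proof (rule ccontr)
      assume "rinner (T x) y \<noteq> 0"
      then show False
        using quad[of "- (rinner (T x) x + 1) / (2 * rinner (T x) y)"] True by (simp add: field_simps)
    qed
    then show ?thesis
      using True by simp
  next
    case False
    then have "0 < rinner (T y) y"
      using nonneg[of y] by simp
    then show ?thesis
      using quad[of "- rinner (T x) y / rinner (T y) y"]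
      by (simp add: field_simps power2_eq_square)
  qed
qed

lemma rinner_le_norm: "\<bar>rinner x y\<bar> \<le> norm x * norm y"
proof -
  have "(rinner x y)\<^sup>2 \<le> (norm x * norm y)\<^sup>2"
    using form_Cauchy_Schwarz[OF symmetric_op_id, of x y] by (simp add: rinner_self power_mult_distrib)
  then show ?thesis
    by (simp add: abs_le_square_iff[symmetric] abs_mult)
qed

lemma bounded_bilinear_rinner: "bounded_bilinear rinner"
  by (rule bounded_bilinear.intro)
     (auto simp: rinner_simps rinner_le_norm intro!: exI[of _ 1])

lemmas tendsto_rinner = bounded_bilinear.tendsto[OF bounded_bilinear_rinner]

lemma rinner_op_le:
  fixes T :: "'a::complex_hilbert \<Rightarrow>\<^sub>L 'a"
  shows "\<bar>rinner (T x) x\<bar> \<le> norm T * (norm x)\<^sup>2"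
proof -
  have "\<bar>rinner (T x) x\<bar> \<le> norm (T x) * norm x"
    by (rule rinner_le_norm)
  also have "\<dots> \<le> (norm T * norm x) * norm x"
    by (intro mult_right_mono norm_blinfun) simp
  finally show ?thesis
    by (simp add: power2_eq_square mult.assoc)
qed

text \<open>This is Cauchy-Schwarz for the form of \<open>T\<close>, at \<open>x\<close> and \<open>T x\<close>.\<close>

lemma norm_op_apply_le_form:
  assumes sym: "symmetric_op T" and nonneg: "\<And>x. 0 \<le> rinner (T x) x"
  shows "(norm (T x))\<^sup>2 \<le> norm T * rinner (T x) x"
proof (cases "T x = 0")
  case False
  have "((norm (T x))\<^sup>2)\<^sup>2 \<le> rinner (T x) x * rinner (T (T x)) (T x)"
    using form_Cauchy_Schwarz[OF assms, of x "T x"] by (simp add: rinner_self)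
  also have "\<dots> \<le> rinner (T x) x * (norm T * (norm (T x))\<^sup>2)"
    using rinner_op_le[of T "T x"] nonneg[of x] by (intro mult_left_mono) auto
  finally have "(norm (T x))\<^sup>2 * (norm (T x))\<^sup>2 \<le> (norm T * rinner (T x) x) * (norm (T x))\<^sup>2"
    by (simp add: power2_eq_square algebra_simps)
  then show ?thesis
    using False by (metis mult_right_le_imp_le zero_less_norm_iff zero_less_power)
qed (use mult_nonneg_nonneg[OF norm_ge_zero nonneg, of T x] in simp)

lemma positive_op_sandwich:
  assumes "positive_op T" "symmetric_op S" "clinear_op S"
  shows "positive_op (S o\<^sub>L T o\<^sub>L S)"
  using assms unfolding positive_op_iff
  by (auto intro: symmetric_op_sandwich clinear_op_compose simp: symmetric_opD[of S])

section \<open>Coercive operators and the spectrum\<close>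

text \<open>The Lax-Milgram argument: for small \<open>e > 0\<close> the map \<open>x \<mapsto> x - e (T x - y)\<close> is a contraction,
  and its fixed points are the solutions of \<open>T x = y\<close>.\<close>

lemma coercive_imp_bij:
  fixes T :: "'a::complex_hilbert \<Rightarrow>\<^sub>L 'a"
  assumes c: "0 < c" and coer: "\<And>x. c * (norm x)\<^sup>2 \<le> rinner (T x) x"
  shows "\<exists>!x. blinfun_apply T x = y"
proof -
  define K where "K = norm T + c"
  \<comment> \<open>This choice minimizes the bound \<open>1 - 2 e c + e\<^sup>2 K\<^sup>2\<close> on the squared contraction factor.\<close>
  define e where "e = c / K\<^sup>2"
  have K: "0 < K" "norm T \<le> K" "c \<le> K"
    using c by (auto simp: K_def add_nonneg_pos)
  have e: "0 < e"
    using c K by (simp add: e_def)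
  have eK: "e\<^sup>2 * K\<^sup>2 = e * c"
    using K by (simp add: e_def power2_eq_square)
  have ec: "0 < e * c" "e * c \<le> 1"
    using c K e by (auto simp: e_def power2_eq_square intro!: mult_mono)
  have contr: "norm (z - e *\<^sub>R T z) \<le> sqrt (1 - e * c) * norm z" for z
  proof -
    have "(norm (z - e *\<^sub>R T z))\<^sup>2 = (norm z)\<^sup>2 - 2 * e * rinner (T z) z + e\<^sup>2 * (norm (T z))\<^sup>2"
      unfolding rinner_self[symmetric] rinner_simps rinner_commute[of z "T z"]
      by (simp add: algebra_simps power2_eq_square)
    also have "\<dots> \<le> (norm z)\<^sup>2 - 2 * e * (c * (norm z)\<^sup>2) + e\<^sup>2 * (K * norm z)\<^sup>2"
    proof -
      have "norm (T z) \<le> K * norm z"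
        using norm_blinfun[of T z] K(2) by (meson mult_right_mono norm_ge_zero order_trans)
      then have "(norm (T z))\<^sup>2 \<le> (K * norm z)\<^sup>2"
        by (simp add: power_mono)
      then have "e\<^sup>2 * (norm (T z))\<^sup>2 \<le> e\<^sup>2 * (K * norm z)\<^sup>2"
        by (simp add: mult_left_mono)
      moreover have "e * (c * (norm z)\<^sup>2) \<le> e * rinner (T z) z"
        using coer[of z] e by simp
      ultimately show ?thesis
        by simp
    qed
    also have "e\<^sup>2 * (K * norm z)\<^sup>2 = e * c * (norm z)\<^sup>2"
      by (simp add: power_mult_distrib mult.assoc[symmetric] eK)
    also have "(norm z)\<^sup>2 - 2 * e * (c * (norm z)\<^sup>2) + e * c * (norm z)\<^sup>2
        = (sqrt (1 - e * c) * norm z)\<^sup>2"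
      using ec by (simp add: power_mult_distrib algebra_simps)
    finally show ?thesis
      by (rule power2_le_imp_le) (use ec in simp)
  qed
  have "\<exists>!x. x - e *\<^sub>R (T x - y) = x"
  proof (rule banach_fix_type)
    show "0 \<le> sqrt (1 - e * c)" "sqrt (1 - e * c) < 1"
      using ec by auto
    show "\<forall>x z. dist (x - e *\<^sub>R (T x - y)) (z - e *\<^sub>R (T z - y)) \<le> sqrt (1 - e * c) * dist x z"
    proof (intro allI)
      fix x z
      have "x - e *\<^sub>R (T x - y) - (z - e *\<^sub>R (T z - y)) = (x - z) - e *\<^sub>R T (x - z)"
        by (simp add: blinfun.diff_right algebra_simps)
      then show "dist (x - e *\<^sub>R (T x - y)) (z - e *\<^sub>R (T z - y)) \<le> sqrt (1 - e * c) * dist x z"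
        using contr[of "x - z"] by (simp only: dist_norm)
    qed
  qed
  then show ?thesis
    using e by simp
qed

lemma coercive_imp_invertible:
  assumes lin: "clinear_op T" and c: "0 < c" and coer: "\<And>x. c * (norm x)\<^sup>2 \<le> rinner (T x) x"
  shows "invertible_op T"
proof -
  define g where "g y = (THE x. blinfun_apply T x = y)" for y
  have bij: "\<exists>!x. blinfun_apply T x = y" for y
    by (rule coercive_imp_bij[OF c coer])
  have Tg: "T (g y) = y" for y
    unfolding g_def by (rule theI'[OF bij])
  have gT: "g (T x) = x" for x
    using bij Tg by blast
  have below: "c * norm x \<le> norm (T x)" for x
  proof (cases "x = 0")
    case False
    have "c * (norm x)\<^sup>2 \<le> norm (T x) * norm x"
      using coer[of x] rinner_le_norm[of "T x" x] by simp
    then show ?thesis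
      using False by (simp add: power2_eq_square)
  qed simp
  have g_eqI: "g y = x" if "T x = y" for x y
    using that gT by blast
  have "bounded_linear g"
  proof (rule bounded_linear_intro[where K = "1 / c"])
    show "g (x + y) = g x + g y" for x y
      by (rule g_eqI) (simp add: blinfun.add_right Tg)
    show "g (r *\<^sub>R x) = r *\<^sub>R g x" for r x
      by (rule g_eqI) (simp add: blinfun.scaleR_right Tg)
    show "norm (g x) \<le> norm x * (1 / c)" for x
      using below[of "g x"] c by (simp add: Tg field_simps)
  qed
  then have app: "blinfun_apply (Blinfun g) = g"
    by (rule bounded_linear_Blinfun_apply)
  have "clinear_op (Blinfun g)"
    unfolding clinear_op_def app
    by (intro allI g_eqI) (simp add: clinear_opD[OF lin] Tg)
  moreover have "Blinfun g o\<^sub>L T = id_blinfun" "T o\<^sub>L Blinfun g = id_blinfun"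
    by (auto intro!: blinfun_eqI simp: app Tg gT)
  ultimately show ?thesis
    unfolding invertible_op_def by blast
qed

lemma invertible_op_uminus:
  assumes "invertible_op T"
  shows "invertible_op (- T)"
proof -
  obtain S where S: "clinear_op S" "S o\<^sub>L T = id_blinfun" "T o\<^sub>L S = id_blinfun"
    using assms by (auto simp: invertible_op_def)
  have ST: "S (T x) = x" and TS: "T (S x) = x" for x
    using S by (metis blinfun_apply_blinfun_compose blinfun_apply_id_blinfun)+
  have "clinear_op (- S)"
    using S(1) by (simp add: clinear_op_def blinfun.minus_left scaleC_minus)
  moreover have "(- S) o\<^sub>L (- T) = id_blinfun" "(- T) o\<^sub>L (- S) = id_blinfun"
    by (auto intro!: blinfun_eqI simp: ST TS blinfun.minus_left blinfun.minus_right)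
  ultimately show ?thesis
    unfolding invertible_op_def by blast
qed

abbreviation real_spectrum :: "('a::complex_hilbert \<Rightarrow>\<^sub>L 'a) \<Rightarrow> real set"
  where "real_spectrum T \<equiv> {x. complex_of_real x \<in> op_spectrum T}"

lemma scalar_op_of_real: "scalar_op (complex_of_real r) = r *\<^sub>R id_blinfun"
  by (rule blinfun_eqI) (simp add: scalar_op.rep_eq scaleC_of_real blinfun.scaleR_left)

lemma real_spectrum_iff: "r \<in> real_spectrum T \<longleftrightarrow> \<not> invertible_op (T - r *\<^sub>R id_blinfun)"
  by (simp add: op_spectrum_def scalar_op_of_real)

text \<open>For real \<open>r < a\<close> the operator \<open>T - r\<close> is coercive, for \<open>r > b\<close> its negative is.\<close>

lemma real_spectrum_subset:
  assumes lin: "clinear_op T"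
    and lower: "\<And>x. a * (norm x)\<^sup>2 \<le> rinner (T x) x"
    and upper: "\<And>x. rinner (T x) x \<le> b * (norm x)\<^sup>2"
  shows "real_spectrum T \<subseteq> {a..b}"
proof (rule subsetI, rule ccontr)
  fix r assume r: "r \<in> real_spectrum T" and "r \<notin> {a..b}"
  then consider "r < a" | "b < r"
    by force
  then have "invertible_op (T - r *\<^sub>R id_blinfun)"
  proof cases
    case 1
    show ?thesis
    proof (rule coercive_imp_invertible[where c = "a - r"])
      show "(a - r) * (norm x)\<^sup>2 \<le> rinner ((T - r *\<^sub>R id_blinfun) x) x" for x
        using lower[of x]
        by (simp add: blinfun.diff_left blinfun.scaleR_left rinner_simps rinner_self algebra_simps)
    qed (use 1 lin in \<open>auto intro: clinear_op_diff clinear_op_scaleR clinear_op_id\<close>)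
  next
    case 2
    have "invertible_op (r *\<^sub>R id_blinfun - T)"
    proof (rule coercive_imp_invertible[where c = "r - b"])
      show "(r - b) * (norm x)\<^sup>2 \<le> rinner ((r *\<^sub>R id_blinfun - T) x) x" for x
        using upper[of x]
        by (simp add: blinfun.diff_left blinfun.scaleR_left rinner_simps rinner_self algebra_simps)
    qed (use 2 lin in \<open>auto intro: clinear_op_diff clinear_op_scaleR clinear_op_id\<close>)
    then show ?thesis
      using invertible_op_uminus[of "r *\<^sub>R id_blinfun - T"] by simp
  qed
  then show False
    using r unfolding real_spectrum_iff by blast
qed

text \<open>The consequence of invertibility that the polynomial argument works with: it passes to
  products and is immediate from a lower bound of the form.\<close>

definition bounded_below_op :: "('a::complex_hilbert \<Rightarrow>\<^sub>L 'a) \<Rightarrow> bool"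
  where "bounded_below_op T \<longleftrightarrow> (\<exists>c>0. \<forall>x. c * norm x \<le> norm (T x))"

lemma invertible_imp_bounded_below:
  assumes "invertible_op T"
  shows "bounded_below_op T"
proof -
  obtain S where S: "S o\<^sub>L T = id_blinfun"
    using assms by (auto simp: invertible_op_def)
  have pos: "0 < norm S + 1"
    by (simp add: add_nonneg_pos)
  have "1 / (norm S + 1) * norm x \<le> norm (T x)" for x
  proof -
    have "norm x = norm (S (T x))"
      using S by (metis blinfun_apply_blinfun_compose blinfun_apply_id_blinfun)
    also have "\<dots> \<le> norm S * norm (T x)"
      by (rule norm_blinfun)
    also have "\<dots> \<le> (norm S + 1) * norm (T x)"
      by (simp add: mult_right_mono)
    finally show ?thesis
      using pos by (simp add: field_simps)
  qed
  then show ?thesis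
    unfolding bounded_below_op_def using pos by (intro exI[of _ "1 / (norm S + 1)"]) simp
qed

lemma bounded_below_op_compose:
  assumes "bounded_below_op S" "bounded_below_op T"
  shows "bounded_below_op (S o\<^sub>L T)"
proof -
  obtain c d where c: "0 < c" "\<And>x. c * norm x \<le> norm (S x)"
    and d: "0 < d" "\<And>x. d * norm x \<le> norm (T x)"
    using assms by (auto simp: bounded_below_op_def)
  have "c * d * norm x \<le> norm (S (T x))" for x
  proof -
    have "c * (d * norm x) \<le> c * norm (T x)"
      using c(1) d(2) by simp
    also have "\<dots> \<le> norm (S (T x))"
      by (rule c(2))
    finally show ?thesis
      by (simp add: mult.assoc)
  qed
  then show ?thesis
    unfolding bounded_below_op_def using c(1) d(1)
    by (intro exI[of _ "c * d"]) simp
qed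

text \<open>Since \<open>\<parallel>T x\<parallel>\<^sup>2 \<le> \<parallel>T\<parallel> \<langle>T x, x\<rangle>\<close>, the form cannot be small where \<open>T x\<close> is not.\<close>

lemma coercive_of_bounded_below:
  assumes sym: "symmetric_op T" and nonneg: "\<And>x. 0 \<le> rinner (T x) x"
    and below: "bounded_below_op T"
  obtains d where "0 < d" "\<And>x. d * (norm x)\<^sup>2 \<le> rinner (T x) x"
proof -
  obtain c where c: "0 < c" "\<And>x. c * norm x \<le> norm (T x)"
    using below by (auto simp: bounded_below_op_def)
  have pos: "0 < norm T + 1"
    by (simp add: add_nonneg_pos)
  show thesis
  proof (rule that[of "c\<^sup>2 / (norm T + 1)"])
    show "0 < c\<^sup>2 / (norm T + 1)"
      using c(1) pos by simp
    fix x
    have "c\<^sup>2 * (norm x)\<^sup>2 \<le> (norm (T x))\<^sup>2"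
      using c(1) c(2)[of x] by (simp add: power_mono flip: power_mult_distrib)
    also have "\<dots> \<le> norm T * rinner (T x) x"
      by (rule norm_op_apply_le_form[OF sym nonneg])
    also have "\<dots> \<le> (norm T + 1) * rinner (T x) x"
      using nonneg[of x] by (simp add: mult_right_mono)
    finally show "c\<^sup>2 / (norm T + 1) * (norm x)\<^sup>2 \<le> rinner (T x) x"
      using pos by (simp add: field_simps)
  qed
qed

section \<open>Polynomials in a symmetric operator\<close>

lemma op_poly_eq_sum:
  assumes "degree p \<le> n"
  shows "op_poly p T = (\<Sum>i\<le>n. coeff p i *\<^sub>R op_power T i)"
  unfolding op_poly_def
  by (rule sum.mono_neutral_left) (use assms in \<open>auto simp: coeff_eq_0\<close>)

lemma op_poly_0: "op_poly 0 T = 0"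
  by (simp add: op_poly_def)

lemma op_poly_pCons: "op_poly (pCons a p) T = a *\<^sub>R id_blinfun + (T o\<^sub>L op_poly p T)"
proof -
  have "op_poly (pCons a p) T = (\<Sum>i\<le>Suc (degree p). coeff (pCons a p) i *\<^sub>R op_power T i)"
    by (rule op_poly_eq_sum) (rule degree_pCons_le)
  also have "\<dots> = a *\<^sub>R id_blinfun + (\<Sum>i\<le>degree p. coeff p i *\<^sub>R (T o\<^sub>L op_power T i))"
    by (simp only: sum.atMost_Suc_shift) (simp add: op_power_def)
  also have "(\<Sum>i\<le>degree p. coeff p i *\<^sub>R (T o\<^sub>L op_power T i)) = T o\<^sub>L op_poly p T"
    by (simp add: op_poly_def bounded_bilinear.sum_right[OF bounded_bilinear_blinfun_compose]
        bounded_bilinear.scaleR_right[OF bounded_bilinear_blinfun_compose])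
  finally show ?thesis .
qed

lemma op_poly_pCons_apply: "op_poly (pCons a p) T x = a *\<^sub>R x + T (op_poly p T x)"
  by (simp add: op_poly_pCons blinfun.add_left blinfun.scaleR_left)

lemma op_poly_add_apply: "op_poly (p + q) T x = op_poly p T x + op_poly q T x"
  by (induction p q rule: poly_induct2)
     (simp_all add: op_poly_0 op_poly_pCons_apply blinfun.add_right algebra_simps)

lemma op_poly_smult_apply: "op_poly (smult c p) T x = c *\<^sub>R op_poly p T x"
  by (induction p) (simp_all add: op_poly_0 op_poly_pCons_apply blinfun.scaleR_right algebra_simps)

lemma op_poly_mult_apply: "op_poly (p * q) T x = op_poly p T (op_poly q T x)"
  by (induction p)
     (simp_all add: op_poly_0 op_poly_pCons_apply op_poly_add_apply op_poly_smult_apply)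

lemma op_poly_diff_apply: "op_poly (p - q) T x = op_poly p T x - op_poly q T x"
  using op_poly_add_apply[of "p - q" q T x] by simp

lemma op_poly_diff: "op_poly (p - q) T = op_poly p T - op_poly q T"
  by (rule blinfun_eqI) (simp add: op_poly_diff_apply blinfun.diff_left)

lemma op_poly_mult: "op_poly (p * q) T = op_poly p T o\<^sub>L op_poly q T"
  by (rule blinfun_eqI) (simp add: op_poly_mult_apply)

lemma op_poly_linear: "op_poly [:a, b:] T = a *\<^sub>R id_blinfun + b *\<^sub>R T"
  by (rule blinfun_eqI)
     (simp add: op_poly_pCons_apply op_poly_0 blinfun.add_left blinfun.scaleR_left blinfun.scaleR_right)

lemma op_poly_const: "op_poly [:a:] T = a *\<^sub>R id_blinfun"
  by (simp add: op_poly_pCons op_poly_0)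

lemma op_poly_apply_commute: "op_poly p T (T x) = T (op_poly p T x)"
  by (induction p) (simp_all add: op_poly_0 op_poly_pCons_apply blinfun.add_right blinfun.scaleR_right)

lemma clinear_op_poly:
  assumes "clinear_op T"
  shows "clinear_op (op_poly p T)"
proof (induction p)
  case 0
  have "c *\<^sub>C (0::'a) = 0" for c
    using scaleC_scaleR[of c 0 0] by simp
  then show ?case
    by (simp add: op_poly_0 clinear_op_def)
next
  case (pCons a p)
  then show ?case
    unfolding op_poly_pCons
    by (intro clinear_op_add clinear_op_scaleR clinear_op_id clinear_op_compose assms)
qed

lemma symmetric_op_poly:
  assumes T: "symmetric_op T"
  shows "symmetric_op (op_poly p T)"
proof (induction p)
  case 0
  show ?case
    using symmetric_op_scaleR[OF T, of 0] by (simp add: op_poly_0)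
next
  case (pCons a p)
  have "rinner (T (op_poly p T x)) y = rinner x (T (op_poly p T y))" for x y
    by (simp add: symmetric_opD[OF T] symmetric_opD[OF pCons.IH] op_poly_apply_commute)
  then show ?case
    by (simp add: symmetric_op_def op_poly_pCons_apply rinner_simps)
qed

lemma poly_of_real_add:
  "poly (map_poly complex_of_real (p + q)) z
    = poly (map_poly complex_of_real p) z + poly (map_poly complex_of_real q) z"
  by (induction p q rule: poly_induct2) (simp_all add: map_poly_pCons algebra_simps)

lemma poly_of_real_mult:
  "poly (map_poly complex_of_real (p * q)) z
    = poly (map_poly complex_of_real p) z * poly (map_poly complex_of_real q) z"
proof (induction p)
  case (pCons a p)
  have smult: "poly (map_poly complex_of_real (smult a q)) z
      = complex_of_real a * poly (map_poly complex_of_real q) z"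
    by (induction q) (simp_all add: map_poly_pCons algebra_simps)
  show ?case
    by (simp add: map_poly_pCons poly_of_real_add smult pCons.IH algebra_simps)
qed simp

text \<open>A nonconstant real polynomial has a complex root \<open>a + b \<i>\<close>; if \<open>b \<noteq> 0\<close>, the remainder modulo
  \<open>(x - a)\<^sup>2 + b\<^sup>2\<close> is a linear real polynomial with that nonreal root, hence zero.\<close>

lemma real_poly_factor:
  fixes p :: "real poly"
  assumes deg: "0 < degree p"
  obtains a q where "p = [:- a, 1:] * q"
  | a b q where "b \<noteq> 0" "p = [:a\<^sup>2 + b\<^sup>2, - 2 * a, 1:] * q"
proof -
  have "degree (map_poly complex_of_real p) = degree p"
    by (rule degree_map_poly) simp
  then have "\<not> (\<exists>a l. a \<noteq> 0 \<and> l = 0 \<and> map_poly complex_of_real p = pCons a l)"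
    using deg by fastforce
  then obtain z where z: "poly (map_poly complex_of_real p) z = 0"
    using fundamental_theorem_of_algebra_alt by blast
  show thesis
  proof (cases "Im z = 0")
    case True
    then have "z = complex_of_real (Re z)"
      by (simp add: complex_eq_iff)
    moreover have "poly (map_poly complex_of_real p) (complex_of_real x) = complex_of_real (poly p x)" for x
      by (induction p) (simp_all add: map_poly_pCons)
    ultimately have "poly p (Re z) = 0"
      using z by (metis of_real_eq_0_iff)
    then show thesis
      using that(1) by (metis dvdE poly_eq_0_iff_dvd)
  next
    case False
    define w where "w = [:(Re z)\<^sup>2 + (Im z)\<^sup>2, - 2 * Re z, 1:]"
    have deg_w: "degree w = 2"
      by (simp add: w_def)
    have w0: "poly (map_poly complex_of_real w) z = 0"
      by (simp add: w_def map_poly_pCons complex_eq_iff power2_eq_square algebra_simps)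
    define r where "r = p mod w"
    have p_eq: "p = w * (p div w) + r"
      by (simp add: r_def)
    have "poly (map_poly complex_of_real r) z = 0"
      using z w0 poly_of_real_add[of "w * (p div w)" r z] poly_of_real_mult[of w "p div w" z] p_eq
      by simp
    moreover have "degree r < 2"
      using degree_mod_less'[of w p] deg_w by (cases "w = 0"; cases "r = 0") (auto simp: r_def)
    then obtain c d where "r = [:c, d:]"
      by (metis degree_eq_zeroE degree_pCons_eq less_2_cases pCons_0_0 pCons_cases pCons_eq_iff
          Suc_inject zero_neq_one One_nat_def)
    ultimately have "r = 0"
      using False by (auto simp: map_poly_pCons complex_eq_iff)
    then show thesis
      using that(2)[OF False, of "Re z" "p div w"] p_eq by (simp add: w_def)
  qed
qed

text \<open>One half of the spectral mapping theorem, in the only form that the positivity argument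
  needs: real linear factors are bounded below because their roots are not in the spectrum,
  quadratic ones because \<open>(T - a)\<^sup>2 + b\<^sup>2 \<ge> b\<^sup>2\<close>.\<close>

lemma bounded_below_op_poly:
  assumes sym: "symmetric_op T"
  shows "p \<noteq> 0 \<Longrightarrow> (\<And>x. x \<in> real_spectrum T \<Longrightarrow> poly p x \<noteq> 0) \<Longrightarrow> bounded_below_op (op_poly p T)"
proof (induction "degree p" arbitrary: p rule: less_induct)
  case less
  show ?case
  proof (cases "degree p = 0")
    case True
    then obtain c where p: "p = [:c:]"
      by (rule degree_eq_zeroE)
    then have "c \<noteq> 0"
      using less.prems(1) by simp
    then show ?thesis
      unfolding bounded_below_op_def p op_poly_const
      by (intro exI[of _ "\<bar>c\<bar>"]) (simp add: blinfun.scaleR_left)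
  next
    case False
    then have "0 < degree p"
      by simp
    then show ?thesis
    proof (cases rule: real_poly_factor)
      case (1 a q)
      have q: "q \<noteq> 0"
        using 1 less.prems(1) by auto
      have deg: "degree q < degree p"
        unfolding 1 by (subst degree_mult_eq) (use q in auto)
      have "a \<notin> real_spectrum T"
        using less.prems(2)[of a] 1 by auto
      then have "bounded_below_op (T - a *\<^sub>R id_blinfun)"
        using invertible_imp_bounded_below unfolding real_spectrum_iff by blast
      moreover have "op_poly [:- a, 1:] T = T - a *\<^sub>R id_blinfun"
        by (simp add: op_poly_linear)
      moreover have "bounded_below_op (op_poly q T)"
        using less.hyps[OF deg q] less.prems(2) 1 by auto
      ultimately show ?thesis
        unfolding 1 op_poly_mult by (simp add: bounded_below_op_compose)
    next
      case (2 a b q)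
      have q: "q \<noteq> 0"
        using 2 less.prems(1) by auto
      have deg: "degree q < degree p"
        unfolding 2 by (subst degree_mult_eq) (use q in auto)
      have "bounded_below_op (op_poly [:a\<^sup>2 + b\<^sup>2, - 2 * a, 1:] T)"
        unfolding bounded_below_op_def
      proof (intro exI conjI allI)
        show "0 < b\<^sup>2"
          using 2(1) by simp
        fix x
        let ?Q = "op_poly [:a\<^sup>2 + b\<^sup>2, - 2 * a, 1:] T"
        have "rinner (?Q x) x = (norm (T x - a *\<^sub>R x))\<^sup>2 + b\<^sup>2 * (norm x)\<^sup>2"
          unfolding rinner_self[symmetric]
          by (simp add: op_poly_pCons_apply op_poly_0 blinfun.add_right blinfun.scaleR_right
              rinner_simps symmetric_opD[OF sym] algebra_simps power2_eq_square)
        then have "b\<^sup>2 * (norm x)\<^sup>2 \<le> rinner (?Q x) x"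
          by simp
        also have "\<dots> \<le> norm (?Q x) * norm x"
          using rinner_le_norm[of "?Q x" x] by simp
        finally show "b\<^sup>2 * norm x \<le> norm (?Q x)"
          by (cases "x = 0") (simp_all add: power2_eq_square[of "norm x"])
      qed
      moreover have "poly q x \<noteq> 0" if "x \<in> real_spectrum T" for x
        using less.prems(2)[OF that] unfolding 2 by auto
      then have "bounded_below_op (op_poly q T)"
        by (rule less.hyps[OF deg q])
      ultimately show ?thesis
        unfolding 2 op_poly_mult by (rule bounded_below_op_compose)
    qed
  qed
qed

text \<open>Let \<open>- m\<close> be the best lower bound of the form of \<open>S = p(T)\<close>. If \<open>m > 0\<close>, then \<open>p + m\<close> has no
  root in the spectrum, so the nonnegative operator \<open>S + m\<close> is bounded below, hence coercive, and
  the bound could be improved. That \<open>p\<close> is not constant excludes \<open>p + m = 0\<close>.\<close>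

lemma op_poly_form_nonneg_nonconst:
  assumes sym: "symmetric_op T" and deg: "0 < degree p"
    and nonneg: "\<And>x. x \<in> real_spectrum T \<Longrightarrow> 0 \<le> poly p x"
  shows "0 \<le> rinner (op_poly p T x) x"
proof -
  define S where "S = op_poly p T"
  have symS: "symmetric_op S"
    unfolding S_def by (rule symmetric_op_poly[OF sym])
  define K where "K = {k. 0 \<le> k \<and> (\<forall>x. - k * (norm x)\<^sup>2 \<le> rinner (S x) x)}"
  define m where "m = Inf K"
  have "norm S \<in> K"
    using rinner_op_le[of S] by (auto simp: K_def abs_le_iff minus_le_iff)
  moreover have bdd: "bdd_below K"
    by (auto simp: K_def bdd_below_def)
  moreover have "closed K"
    unfolding K_def
    by (intro closed_Collect_conj closed_Collect_all closed_Collect_le continuous_intros)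
  ultimately have "m \<in> K"
    unfolding m_def by (intro closed_contains_Inf) auto
  then have m: "0 \<le> m" "\<And>x. - m * (norm x)\<^sup>2 \<le> rinner (S x) x"
    by (auto simp: K_def)
  have "m = 0"
  proof (rule ccontr)
    assume "m \<noteq> 0"
    then have "0 < m"
      using m(1) by simp
    define q where "q = p + [:m:]"
    have Sq: "op_poly q T x = S x + m *\<^sub>R x" for x
      by (simp add: q_def op_poly_add_apply op_poly_const S_def blinfun.scaleR_left)
    have q: "q \<noteq> 0"
    proof
      assume "q = 0"
      moreover have "p = q - [:m:]"
        by (simp add: q_def)
      ultimately show False
        using deg by simp
    qed
    have "bounded_below_op (op_poly q T)"
    proof (rule bounded_below_op_poly[OF sym q])
      show "poly q x \<noteq> 0" if "x \<in> real_spectrum T" for x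
        using nonneg[OF that] \<open>0 < m\<close> by (simp add: q_def)
    qed
    moreover have "0 \<le> rinner (op_poly q T x) x" for x
      using m(2)[of x] by (simp add: Sq rinner_simps rinner_self)
    ultimately obtain d where d: "0 < d" "\<And>x. d * (norm x)\<^sup>2 \<le> rinner (op_poly q T x) x"
      using coercive_of_bounded_below[OF symmetric_op_poly[OF sym]] by metis
    define k where "k = max 0 (m - d)"
    have "- k * (norm x)\<^sup>2 \<le> rinner (S x) x" for x
    proof -
      have "- k * (norm x)\<^sup>2 \<le> (d - m) * (norm x)\<^sup>2"
        by (rule mult_right_mono) (auto simp: k_def)
      then show ?thesis
        using d(2)[of x] by (simp add: Sq rinner_simps rinner_self algebra_simps)
    qed
    then have "k \<in> K"
      by (simp add: K_def k_def)
    then have "m \<le> k"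
      unfolding m_def by (rule cInf_lower[OF _ bdd])
    then show False
      using d(1) \<open>0 < m\<close> by (simp add: k_def)
  qed
  then show ?thesis
    using m(2)[of x] by (simp add: S_def)
qed

text \<open>A negative constant is nonnegative on the spectrum only if the spectrum is empty; then every
  \<open>T - k\<close> has nonnegative form, which leaves only the zero vector.\<close>

lemma op_poly_form_nonneg:
  assumes sym: "symmetric_op T"
    and nonneg: "\<And>x. x \<in> real_spectrum T \<Longrightarrow> 0 \<le> poly p x"
  shows "0 \<le> rinner (op_poly p T x) x"
proof (cases "degree p = 0")
  case False
  then show ?thesis
    using op_poly_form_nonneg_nonconst[OF sym _ nonneg] by simp
next
  case True
  then obtain c where p: "p = [:c:]"
    by (rule degree_eq_zeroE)
  show ?thesis
  proof (cases "0 \<le> c")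
    case True
    then show ?thesis
      by (simp add: p op_poly_const blinfun.scaleR_left rinner_simps rinner_self)
  next
    case False
    then have "real_spectrum T = {}"
      using nonneg by (auto simp: p)
    then have "0 \<le> rinner (op_poly [:- (norm T + 1), 1:] T x) x"
      by (intro op_poly_form_nonneg_nonconst[OF sym]) auto
    then have "(norm T + 1) * (norm x)\<^sup>2 \<le> rinner (T x) x"
      by (simp add: op_poly_linear blinfun.add_left blinfun.scaleR_left blinfun.diff_left
          blinfun.minus_left rinner_simps rinner_self algebra_simps)
    also have "\<dots> \<le> norm T * (norm x)\<^sup>2"
      using abs_le_D1[OF rinner_op_le[of T x]] .
    finally have "x = 0"
      by (simp add: algebra_simps)
    then show ?thesis
      by (simp add: rinner_def bounded_bilinear.zero_left[OF bounded_bilinear_rinner, unfolded rinner_def])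
  qed
qed

text \<open>With \<open>M\<^sup>2 - p\<^sup>2 \<ge> 0\<close> on the spectrum, \<open>\<parallel>p(T) x\<parallel>\<^sup>2 = \<langle>p(T)\<^sup>2 x, x\<rangle> \<le> M\<^sup>2 \<parallel>x\<parallel>\<^sup>2\<close>.\<close>

lemma norm_op_poly_le:
  assumes sym: "symmetric_op T" and M: "0 \<le> M"
    and bound: "\<And>x. x \<in> real_spectrum T \<Longrightarrow> \<bar>poly p x\<bar> \<le> M"
  shows "norm (op_poly p T) \<le> M"
proof (rule norm_blinfun_bound[OF M])
  fix x
  have "0 \<le> rinner (op_poly ([:M\<^sup>2:] - p * p) T x) x"
  proof (rule op_poly_form_nonneg[OF sym])
    show "0 \<le> poly ([:M\<^sup>2:] - p * p) x" if "x \<in> real_spectrum T" for x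
      using bound[OF that] M abs_le_square_iff[of "poly p x" M] by (simp add: power2_eq_square)
  qed
  then have "rinner (op_poly p T (op_poly p T x)) x \<le> M\<^sup>2 * (norm x)\<^sup>2"
    by (simp add: op_poly_diff_apply op_poly_mult_apply op_poly_const blinfun.scaleR_left
        rinner_simps rinner_self)
  then have "(norm (op_poly p T x))\<^sup>2 \<le> (M * norm x)\<^sup>2"
    by (simp add: symmetric_opD[OF symmetric_op_poly[OF sym]] rinner_self power_mult_distrib)
  then show "norm (op_poly p T x) \<le> M * norm x"
    by (rule power2_le_imp_le) (use M in simp)
qed

section \<open>The continuous functional calculus\<close>

text \<open>By the norm bound, polynomials that are uniformly close on the spectrum are close at \<open>T\<close>.
  One approximating sequence therefore determines the limit for all of them, so the description
  in the definition of \<^const>\<open>cfc\<close> has a unique solution.\<close>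

lemma cfc_tendsto:
  assumes sym: "symmetric_op T"
    and lim: "uniform_limit (real_spectrum T) (\<lambda>n. poly (p n)) f sequentially"
  shows "(\<lambda>n. op_poly (p n) T) \<longlonglongrightarrow> cfc f T"
proof -
  have close: "norm (op_poly q T - op_poly r T) < e"
    if e: "0 < e" and q: "\<forall>x\<in>real_spectrum T. dist (poly q x) (f x) < e / 4"
      and r: "\<forall>x\<in>real_spectrum T. dist (poly r x) (f x) < e / 4" for q r e
  proof -
    have "norm (op_poly (q - r) T) \<le> e / 2"
    proof (rule norm_op_poly_le[OF sym])
      show "\<bar>poly (q - r) x\<bar> \<le> e / 2" if "x \<in> real_spectrum T" for x
      proof -
        have "dist (poly q x) (f x) < e / 4" "dist (poly r x) (f x) < e / 4"
          using q r that by auto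
        then show ?thesis
          unfolding dist_real_def poly_diff by linarith
      qed
    qed (use e in simp)
    then show ?thesis
      using e by (simp add: op_poly_diff)
  qed
  have "Cauchy (\<lambda>n. op_poly (p n) T)"
  proof (rule CauchyI)
    fix e :: real assume e: "0 < e"
    then obtain N where "\<And>n. N \<le> n \<Longrightarrow> \<forall>x\<in>real_spectrum T. dist (poly (p n) x) (f x) < e / 4"
      using uniform_limitD[OF lim, of "e / 4"] by (auto simp: eventually_sequentially)
    then show "\<exists>M. \<forall>m\<ge>M. \<forall>n\<ge>M. norm (op_poly (p m) T - op_poly (p n) T) < e"
      using close[OF e] by meson
  qed
  then obtain L where L: "(\<lambda>n. op_poly (p n) T) \<longlonglongrightarrow> L"
    using Cauchy_convergent convergent_def by blast
  have all: "(\<lambda>n. op_poly (q n) T) \<longlonglongrightarrow> L"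
    if q: "uniform_limit (real_spectrum T) (\<lambda>n. poly (q n)) f sequentially" for q
  proof -
    have "(\<lambda>n. op_poly (q n) T - op_poly (p n) T) \<longlonglongrightarrow> 0"
    proof (rule tendstoI)
      fix e :: real assume e: "0 < e"
      then have e4: "0 < e / 4"
        by simp
      show "\<forall>\<^sub>F n in sequentially. dist (op_poly (q n) T - op_poly (p n) T) 0 < e"
        using uniform_limitD[OF q e4] uniform_limitD[OF lim e4]
        by eventually_elim (use close[OF e] in simp)
    qed
    from tendsto_add[OF this L] show ?thesis
      by simp
  qed
  have "cfc f T = L"
    unfolding cfc_def
  proof (rule the_equality)
    show "S = L" if "\<forall>p :: nat \<Rightarrow> real poly. uniform_limit (real_spectrum T) (\<lambda>n. poly (p n)) f sequentially
        \<longrightarrow> (\<lambda>n. op_poly (p n) T) \<longlonglongrightarrow> S" for S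
      using that lim L LIMSEQ_unique by blast
  qed (use all in blast)
  with L show ?thesis
    by simp
qed

lemma cfc_cong:
  assumes "\<And>x. x \<in> real_spectrum T \<Longrightarrow> f x = g x"
  shows "cfc f T = cfc g T"
proof -
  have "uniform_limit (real_spectrum T) F f sequentially
      \<longleftrightarrow> uniform_limit (real_spectrum T) F g sequentially" for F
    by (rule uniform_limit_cong') (use assms in auto)
  then show ?thesis
    by (simp add: cfc_def)
qed

lemma cfc_poly:
  assumes "symmetric_op T"
  shows "cfc (poly p) T = op_poly p T"
  using cfc_tendsto[OF assms uniform_limit_const, of p] by (simp add: LIMSEQ_const_iff)

lemma uniform_limit_poly_exists:
  fixes f :: "real \<Rightarrow> real"
  assumes "continuous_on {a..b} f" "S \<subseteq> {a..b}"
  obtains p where "uniform_limit S (\<lambda>n. poly (p n)) f sequentially"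
proof -
  obtain g where g: "uniform_limit {a..b} g f sequentially" "\<And>n :: nat. polynomial_function (g n)"
    using Stone_Weierstrass_uniform_limit[of "{a..b}" f] assms(1) by auto
  have "\<exists>q. g n = poly q" for n
  proof -
    obtain c k where "g n = (\<lambda>x. \<Sum>i\<le>k. c i * x ^ i)"
      using g(2)[of n] by (auto simp: real_polynomial_function_iff_sum simp flip: real_polynomial_function_eq)
    then have "g n = poly (\<Sum>i\<le>k. monom (c i) i)"
      by (auto simp: poly_sum poly_monom)
    then show ?thesis ..
  qed
  then obtain p where "\<And>n. g n = poly (p n)"
    by metis
  then have "uniform_limit {a..b} (\<lambda>n. poly (p n)) f sequentially"
    using g(1) by (metis (no_types, lifting) ext)
  then show thesis
    using that uniform_limit_on_subset assms(2) by blast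
qed

context
  fixes T :: "'a::complex_hilbert \<Rightarrow>\<^sub>L 'a" and a b :: real
  assumes sym: "symmetric_op T" and lin: "clinear_op T" and spec: "real_spectrum T \<subseteq> {a..b}"
begin

lemma symmetric_op_cfc:
  assumes "continuous_on {a..b} f"
  shows "symmetric_op (cfc f T)"
proof -
  obtain p where p: "uniform_limit (real_spectrum T) (\<lambda>n. poly (p n)) f sequentially"
    using uniform_limit_poly_exists[OF assms spec] .
  have lim: "(\<lambda>n. op_poly (p n) T x) \<longlonglongrightarrow> cfc f T x" for x
    by (intro blinfun.tendsto cfc_tendsto sym p tendsto_const)
  have "rinner (cfc f T x) y = rinner x (cfc f T y)" for x y
  proof (rule LIMSEQ_unique)
    show "(\<lambda>n. rinner (op_poly (p n) T x) y) \<longlonglongrightarrow> rinner (cfc f T x) y"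
      by (intro tendsto_rinner lim tendsto_const)
    show "(\<lambda>n. rinner (op_poly (p n) T x) y) \<longlonglongrightarrow> rinner x (cfc f T y)"
      unfolding symmetric_opD[OF symmetric_op_poly[OF sym]]
      by (intro tendsto_rinner lim tendsto_const)
  qed
  then show ?thesis
    by (simp add: symmetric_op_def)
qed

lemma clinear_op_cfc:
  assumes "continuous_on {a..b} f"
  shows "clinear_op (cfc f T)"
proof -
  obtain p where p: "uniform_limit (real_spectrum T) (\<lambda>n. poly (p n)) f sequentially"
    using uniform_limit_poly_exists[OF assms spec] .
  have lim: "(\<lambda>n. op_poly (p n) T x) \<longlonglongrightarrow> cfc f T x" for x
    by (intro blinfun.tendsto cfc_tendsto sym p tendsto_const)
  have "cfc f T (c *\<^sub>C x) = c *\<^sub>C cfc f T x" for c x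
  proof (rule LIMSEQ_unique)
    show "(\<lambda>n. op_poly (p n) T (c *\<^sub>C x)) \<longlonglongrightarrow> cfc f T (c *\<^sub>C x)"
      by (rule lim)
    show "(\<lambda>n. op_poly (p n) T (c *\<^sub>C x)) \<longlonglongrightarrow> c *\<^sub>C cfc f T x"
      unfolding clinear_opD[OF clinear_op_poly[OF lin]]
      by (intro bounded_linear.tendsto[OF bounded_linear_scaleC] lim)
  qed
  then show ?thesis
    by (simp add: clinear_op_def)
qed

lemma cfc_mult:
  assumes f: "continuous_on {a..b} f" and g: "continuous_on {a..b} g"
  shows "cfc (\<lambda>x. f x * g x) T = cfc f T o\<^sub>L cfc g T"
proof -
  obtain p where p: "uniform_limit (real_spectrum T) (\<lambda>n. poly (p n)) f sequentially"
    using uniform_limit_poly_exists[OF f spec] .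
  obtain q where q: "uniform_limit (real_spectrum T) (\<lambda>n. poly (q n)) g sequentially"
    using uniform_limit_poly_exists[OF g spec] .
  have bdd: "bounded (h ` real_spectrum T)" if "continuous_on {a..b} h" for h :: "real \<Rightarrow> real"
    using compact_imp_bounded[OF compact_continuous_image[OF that compact_Icc]]
    by (rule bounded_subset) (use spec in blast)
  have "uniform_limit (real_spectrum T) (\<lambda>n. poly (p n * q n)) (\<lambda>x. f x * g x) sequentially"
    using uniform_lim_mult[OF p q bdd[OF f] bdd[OF g]] by (simp add: poly_mult[abs_def])
  then have "(\<lambda>n. op_poly (p n * q n) T) \<longlonglongrightarrow> cfc (\<lambda>x. f x * g x) T"
    by (rule cfc_tendsto[OF sym])
  moreover have "(\<lambda>n. op_poly (p n * q n) T) \<longlonglongrightarrow> (cfc f T o\<^sub>L cfc g T)"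
    unfolding op_poly_mult
    by (intro bounded_bilinear.tendsto[OF bounded_bilinear_blinfun_compose] cfc_tendsto sym p q)
  ultimately show ?thesis
    by (rule LIMSEQ_unique)
qed

lemma cfc_diff:
  assumes f: "continuous_on {a..b} f" and g: "continuous_on {a..b} g"
  shows "cfc (\<lambda>x. f x - g x) T = cfc f T - cfc g T"
proof -
  obtain p where p: "uniform_limit (real_spectrum T) (\<lambda>n. poly (p n)) f sequentially"
    using uniform_limit_poly_exists[OF f spec] .
  obtain q where q: "uniform_limit (real_spectrum T) (\<lambda>n. poly (q n)) g sequentially"
    using uniform_limit_poly_exists[OF g spec] .
  have "uniform_limit (real_spectrum T) (\<lambda>n. poly (p n - q n)) (\<lambda>x. f x - g x) sequentially"
    using uniform_limit_minus[OF p q] by (simp add: poly_diff[abs_def])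
  then have "(\<lambda>n. op_poly (p n - q n) T) \<longlonglongrightarrow> cfc (\<lambda>x. f x - g x) T"
    by (rule cfc_tendsto[OF sym])
  moreover have "(\<lambda>n. op_poly (p n - q n) T) \<longlonglongrightarrow> cfc f T - cfc g T"
    unfolding op_poly_diff by (intro tendsto_diff cfc_tendsto sym p q)
  ultimately show ?thesis
    by (rule LIMSEQ_unique)
qed

text \<open>A nonnegative \<open>f\<close> has a continuous square root, and the square of a symmetric operator is
  positive.\<close>

lemma positive_op_cfc:
  assumes f: "continuous_on {a..b} f" and nonneg: "\<And>x. x \<in> {a..b} \<Longrightarrow> 0 \<le> f x"
  shows "positive_op (cfc f T)"
proof -
  have g: "continuous_on {a..b} (\<lambda>x. sqrt (f x))"
    using f by (rule continuous_on_real_sqrt)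
  have "cfc f T = cfc (\<lambda>x. sqrt (f x) * sqrt (f x)) T"
    by (rule cfc_cong) (use spec nonneg in auto)
  also have "\<dots> = cfc (\<lambda>x. sqrt (f x)) T o\<^sub>L id_blinfun o\<^sub>L cfc (\<lambda>x. sqrt (f x)) T"
    unfolding cfc_mult[OF g g] by (rule blinfun_eqI) simp
  also have "positive_op \<dots>"
    by (intro positive_op_sandwich symmetric_op_cfc clinear_op_cfc g)
       (simp add: positive_op_iff clinear_op_id symmetric_op_id rinner_self)
  finally show ?thesis .
qed

end

section \<open>The gap between the scalar means\<close>

text \<open>The sign of the second derivative is that of \<open>v (v - 1)\<close>.\<close>

lemma powr_convex_on:
  assumes v: "v \<notin> {0..1}"
  shows "convex_on {0<..} (\<lambda>x::real. x powr v)"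
proof (rule f''_ge0_imp_convex)
  show "((\<lambda>x. x powr v) has_real_derivative v * x powr (v - 1)) (at x)" if "x \<in> {0<..}" for x
    using that by (auto intro!: derivative_eq_intros)
  show "((\<lambda>x. v * x powr (v - 1)) has_real_derivative v * ((v - 1) * x powr (v - 1 - 1))) (at x)"
    if "x \<in> {0<..}" for x
    using that by (auto intro!: derivative_eq_intros)
  have "0 \<le> v * (v - 1)"
    using v by (auto simp: zero_le_mult_iff)
  then show "0 \<le> v * ((v - 1) * x powr (v - 1 - 1))" for x
    by (metis mult.assoc mult_nonneg_nonneg powr_ge_zero)
qed simp

text \<open>The gap is concave, so on an interval it is minimal at an end point.\<close>

lemma mean_gap_ge_min:
  assumes v: "v \<notin> {0..1}" and s: "0 < s" and x: "x \<in> {s..t}"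
  shows "min (mean_gap v s) (mean_gap v t) \<le> mean_gap v x"
proof (cases "s = t")
  case True
  then show ?thesis
    using x by auto
next
  case False
  then have st: "s < t"
    using x by auto
  define u where "u = (x - s) / (t - s)"
  have u: "0 \<le> u" "u \<le> 1"
    using x st by (auto simp: u_def field_simps)
  have "u * (t - s) = x - s"
    using st by (simp add: u_def)
  then have x_eq: "x = (1 - u) * s + u * t"
    by (simp add: algebra_simps)
  have "x powr v \<le> (1 - u) * s powr v + u * t powr v"
    using convex_onD[OF powr_convex_on[OF v] u, of s t] s st x_eq by simp
  moreover have "(1 - u) * mean_gap v s + u * mean_gap v t
      = (1 - v) + v * ((1 - u) * s + u * t) - ((1 - u) * s powr v + u * t powr v)"
    by (simp add: mean_gap_def algebra_simps)
  ultimately have "(1 - u) * mean_gap v s + u * mean_gap v t \<le> mean_gap v x"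
    by (simp add: mean_gap_def flip: x_eq)
  moreover have "(1 - u) * min (mean_gap v s) (mean_gap v t) + u * min (mean_gap v s) (mean_gap v t)
      \<le> (1 - u) * mean_gap v s + u * mean_gap v t"
    using u by (intro add_mono mult_left_mono) auto
  ultimately show ?thesis
    by (simp add: algebra_simps)
qed

lemma continuous_on_powr_Icc: "0 < a \<Longrightarrow> continuous_on {a..b} (\<lambda>x::real. x powr v)"
  by (intro continuous_intros) auto

section \<open>The operator inequality\<close>

lemma strictly_positive_op_bounds:
  assumes "strictly_positive_op A"
  obtains a b where "0 < a" "real_spectrum A \<subseteq> {a..b}"
proof -
  have A: "clinear_op A" "symmetric_op A" "\<And>x. 0 \<le> rinner (A x) x" "invertible_op A"
    using assms by (auto simp: strictly_positive_op_def positive_op_iff)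
  obtain a where a: "0 < a" "\<And>x. a * (norm x)\<^sup>2 \<le> rinner (A x) x"
    using coercive_of_bounded_below[OF A(2,3) invertible_imp_bounded_below[OF A(4)]] by blast
  have "real_spectrum A \<subseteq> {a..norm A}"
    by (rule real_spectrum_subset[OF A(1) a(2)]) (use rinner_op_le abs_le_D1 in blast)
  with a(1) show thesis
    by (rule that)
qed

theorem mainTheorem7:
  fixes A B :: "'a::complex_hilbert \<Rightarrow>\<^sub>L 'a"
    and s t v :: real
  assumes "strictly_positive_op A" and "strictly_positive_op B"
    and "0 < s" and "s \<le> t"
    and "s *\<^sub>R A \<preceq> B" and "B \<preceq> t *\<^sub>R A"
    and "v \<notin> {0..1}"
  shows "min (mean_gap v s) (mean_gap v t) *\<^sub>R A \<preceq> arith_mean_op v A B - geom_mean_op v A B"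
proof -
  have A: "clinear_op A" "symmetric_op A"
    using assms(1) by (auto simp: strictly_positive_op_def positive_op_iff)
  have B: "clinear_op B" "symmetric_op B"
    using assms(2) by (auto simp: strictly_positive_op_def positive_op_iff)
  obtain a b where a: "0 < a" and spec: "real_spectrum A \<subseteq> {a..b}"
    using strictly_positive_op_bounds[OF assms(1)] .
  note cont = continuous_on_powr_Icc[OF a]
  define H where "H = op_powr A (1/2)"
  define K where "K = op_powr A (-1/2)"
  have H: "symmetric_op H" "clinear_op H" and K: "symmetric_op K" "clinear_op K"
    unfolding H_def K_def op_powr_def
    by (intro symmetric_op_cfc[OF A(2,1) spec] clinear_op_cfc[OF A(2,1) spec] cont)+
  have pos: "0 < x" if "x \<in> real_spectrum A" for x
    using that spec a by force
  have powr_compose: "op_powr A c o\<^sub>L op_powr A d = op_poly p A"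
    if "\<And>x. 0 < x \<Longrightarrow> x powr (c + d) = poly p x" for c d p
  proof -
    have "op_powr A c o\<^sub>L op_powr A d = cfc (\<lambda>x. x powr c * x powr d) A"
      unfolding op_powr_def by (rule cfc_mult[OF A(2,1) spec cont cont, symmetric])
    also have "\<dots> = cfc (poly p) A"
      by (rule cfc_cong) (use pos that in \<open>simp flip: powr_add\<close>)
    finally show ?thesis
      by (simp add: cfc_poly[OF A(2)])
  qed
  \<comment> \<open>The exponents add up to \<open>1\<close> or \<open>0\<close>, where the power agrees with a polynomial for \<open>x > 0\<close>.\<close>
  have "H o\<^sub>L H = op_poly [:0, 1:] A" "H o\<^sub>L K = op_poly [:1:] A" "K o\<^sub>L H = op_poly [:1:] A"
    unfolding H_def K_def by (rule powr_compose; simp)+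
  then have HH: "H (H x) = A x" and HK: "H (K x) = x" and KH: "K (H x) = x" for x
    by (simp_all add: op_poly_linear op_poly_const flip: blinfun_apply_blinfun_compose)
  define C where "C = K o\<^sub>L B o\<^sub>L K"
  have C: "symmetric_op C" "clinear_op C"
    unfolding C_def by (intro symmetric_op_sandwich clinear_op_compose K B)+
  have KAK: "rinner (A (K x)) (K x) = (norm x)\<^sup>2" for x
    by (simp add: HH[symmetric] HK symmetric_opD[OF H(1)] rinner_self)
  have CB: "rinner (C x) x = rinner (B (K x)) (K x)" for x
    by (simp add: C_def symmetric_opD[OF K(1)])
  have spec_C: "real_spectrum C \<subseteq> {s..t}"
  proof (rule real_spectrum_subset[OF C(2)])
    show "s * (norm x)\<^sup>2 \<le> rinner (C x) x" "rinner (C x) x \<le> t * (norm x)\<^sup>2" for x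
      using assms(5,6)
      by (simp_all add: le_op_def positive_op_iff blinfun.diff_left blinfun.scaleR_left rinner_simps
          CB KAK[symmetric])
  qed
  define m where "m = min (mean_gap v s) (mean_gap v t)"
  \<comment> \<open>\<open>D\<close> is the scalar gap minus \<open>m\<close>, evaluated at \<open>C\<close>.\<close>
  define D where "D = cfc (\<lambda>x. poly [:1 - v - m, v:] x - x powr v) C"
  have cont_C: "continuous_on {s..t} (\<lambda>x. x powr v)"
    by (rule continuous_on_powr_Icc[OF assms(3)])
  have cont_poly: "continuous_on {s..t} (poly [:1 - v - m, v:])"
    by (intro continuous_intros)
  have "positive_op D"
    unfolding D_def
  proof (rule positive_op_cfc[OF C spec_C continuous_on_diff[OF cont_poly cont_C]])
    show "0 \<le> poly [:1 - v - m, v:] x - x powr v" if "x \<in> {s..t}" for x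
      using mean_gap_ge_min[OF assms(7,3) that] by (simp add: m_def mean_gap_def algebra_simps)
  qed
  then have "positive_op (H o\<^sub>L D o\<^sub>L H)"
    by (intro positive_op_sandwich H)
  moreover have "H o\<^sub>L D o\<^sub>L H = arith_mean_op v A B - geom_mean_op v A B - m *\<^sub>R A"
  proof (rule blinfun_eqI)
    fix x
    have "D = (1 - v - m) *\<^sub>R id_blinfun + v *\<^sub>R C - op_powr C v"
      unfolding D_def op_powr_def
      by (simp only: cfc_diff[OF C spec_C cont_poly cont_C] cfc_poly[OF C(1)] op_poly_linear)
    moreover have "C (H x) = K (B x)"
      by (simp add: C_def KH)
    ultimately have "D (H x) = (1 - v - m) *\<^sub>R H x + v *\<^sub>R K (B x) - op_powr C v (H x)"
      by (simp add: blinfun.diff_left blinfun.add_left blinfun.scaleR_left)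
    moreover have "geom_mean_op v A B x = H (op_powr C v (H x))"
      by (simp add: geom_mean_op_def H_def K_def C_def)
    ultimately have "H (D (H x)) = (1 - v - m) *\<^sub>R A x + v *\<^sub>R B x - geom_mean_op v A B x"
      by (simp add: blinfun.diff_right blinfun.add_right blinfun.scaleR_right HH HK)
    then show "(H o\<^sub>L D o\<^sub>L H) x = (arith_mean_op v A B - geom_mean_op v A B - m *\<^sub>R A) x"
      by (simp add: arith_mean_op_def blinfun.diff_left blinfun.add_left blinfun.scaleR_left
          algebra_simps)
  qed
  ultimately show ?thesis
    by (simp add: le_op_def m_def)
qed

end
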